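(* Let $X$ be a Hausdorff topological space and $Y$ a Hausdorff locally convex linear topological space in which the closed convex hull of every compact set is compact. Then the map $\varphi$ defined on $MU(X,Y)$ by $\varphi(F)(x)=\overline{co}\,F(x)$ for all $x\in X$ is a bijection from $MU(X,Y)$ to $MC(X,Y)$.
   Context: A set-valued map $F$ from $X$ to $Y$ assigns to each $x\in X$ a subset $F(x)\subset Y$. Write $G\subset F$ if $G(x)\subset F(x)$ for all $x\in X$. $F$ is upper semicontinuous if for every $x\in X$ and every open $V\supset F(x)$ there is an open neighborhood $U$ of $x$ with $F(u)\subset V$ for all $u\in U$. $F$ is usco if it is upper semicontinuous and all its values are nonempty and compact; $F$ is cusco if it is usco and all its values are convex. $F$ is minimal usco (minimal cusco) if it is usco (cusco) and does not properly contain any other usco (cusco) map from $X$ to $Y$. $MU(X,Y)$ and $MC(X,Y)$ denote the sets of all minimal usco and all minimal cusco maps from $X$ to $Y$, respectively. $\overline{co}\,B$ denotes the closed convex hull of $B\subset Y$. *)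

theory Defs
  imports "HOL-Analysis.Analysis"
begin

text \<open>
  Real locally convex linear topological spaces. The Hausdorff property is not part of the class;
  it is imposed separately by the sort \<open>t2_space\<close>.
\<close>

class locally_convex_space = real_vector + topological_ab_group_add +
  assumes tendsto_scaleR_Pair:
    "LIM p (nhds a \<times>\<^sub>F nhds x). fst p *\<^sub>R snd p :> nhds (a *\<^sub>R x)"
  \<comment> \<open>The quantified clause is \<open>convex V\<close> written out: the constant \<open>convex\<close> cannot be used on the
      type parameter of a class specification.\<close>
  assumes locally_convex_0_unfolded:
    "open U \<Longrightarrow> 0 \<in> U \<Longrightarrow> \<exists>V. open V \<and> 0 \<in> V \<and> V \<subseteq> U \<and>
       (\<forall>x\<in>V. \<forall>y\<in>V. \<forall>u\<ge>0. \<forall>v\<ge>0. u + v = 1 \<longrightarrow> u *\<^sub>R x + v *\<^sub>R y \<in> V)"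

lemma locally_convex_0:
  fixes U :: "'b::locally_convex_space set"
  assumes "open U" "0 \<in> U"
  shows "\<exists>V. open V \<and> convex V \<and> 0 \<in> V \<and> V \<subseteq> U"
  using locally_convex_0_unfolded[OF assms] unfolding convex_def by blast

instance real_normed_vector \<subseteq> locally_convex_space
proof
  fix a :: real and x :: 'a
  have 1: "filterlim fst (nhds a) (nhds a \<times>\<^sub>F nhds x)" by (rule filterlim_fst)
  have 2: "filterlim snd (nhds x) (nhds a \<times>\<^sub>F nhds x)" by (rule filterlim_snd)
  show "LIM p (nhds a \<times>\<^sub>F nhds x). fst p *\<^sub>R snd p :> nhds (a *\<^sub>R x)"
    by (rule tendsto_scaleR[OF 1 2])
next
  fix U :: "'a set"
  assume "open U" "0 \<in> U"
  then obtain e where e: "e > 0" "ball 0 e \<subseteq> U"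
    using open_contains_ball by blast
  show "\<exists>V. open V \<and> 0 \<in> V \<and> V \<subseteq> U \<and>
       (\<forall>x\<in>V. \<forall>y\<in>V. \<forall>u\<ge>0. \<forall>v\<ge>0. u + v = 1 \<longrightarrow> u *\<^sub>R x + v *\<^sub>R y \<in> V)"
    using e convex_ball[of "0::'a" e] unfolding convex_def
    by (intro exI[of _ "ball 0 e"]) auto
qed

definition closed_convex_hull :: "'b::{real_vector, topological_space} set \<Rightarrow> 'b set" where
  "closed_convex_hull B = closure (convex hull B)"

definition submap :: "('a \<Rightarrow> 'b set) \<Rightarrow> ('a \<Rightarrow> 'b set) \<Rightarrow> bool" where
  "submap G F \<longleftrightarrow> (\<forall>x. G x \<subseteq> F x)"

definition upper_semicontinuous ::
    "('a::topological_space \<Rightarrow> 'b::topological_space set) \<Rightarrow> bool" where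
  "upper_semicontinuous F \<longleftrightarrow>
    (\<forall>x V. open V \<and> F x \<subseteq> V \<longrightarrow> (\<exists>U. open U \<and> x \<in> U \<and> (\<forall>u\<in>U. F u \<subseteq> V)))"

definition usco :: "('a::topological_space \<Rightarrow> 'b::topological_space set) \<Rightarrow> bool" where
  "usco F \<longleftrightarrow> upper_semicontinuous F \<and> (\<forall>x. F x \<noteq> {} \<and> compact (F x))"

definition cusco ::
    "('a::topological_space \<Rightarrow> 'b::{real_vector, topological_space} set) \<Rightarrow> bool" where
  "cusco F \<longleftrightarrow> usco F \<and> (\<forall>x. convex (F x))"

definition minimal_usco :: "('a::topological_space \<Rightarrow> 'b::topological_space set) \<Rightarrow> bool" where
  "minimal_usco F \<longleftrightarrow> usco F \<and> (\<forall>G. usco G \<and> submap G F \<longrightarrow> G = F)"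

definition minimal_cusco ::
    "('a::topological_space \<Rightarrow> 'b::{real_vector, topological_space} set) \<Rightarrow> bool" where
  "minimal_cusco F \<longleftrightarrow> cusco F \<and> (\<forall>G. cusco G \<and> submap G F \<longrightarrow> G = F)"

definition MU :: "('a::topological_space \<Rightarrow> 'b::topological_space set) set" where
  "MU = {F. minimal_usco F}"

definition MC :: "('a::topological_space \<Rightarrow> 'b::{real_vector, topological_space} set) set" where
  "MC = {F. minimal_cusco F}"

definition hull_map :: "('a \<Rightarrow> 'b::{real_vector, topological_space} set) \<Rightarrow> 'a \<Rightarrow> 'b set" where
  "hull_map F = (\<lambda>x. closed_convex_hull (F x))"

end

theory Submission imports Defs begin

text \<open>
  The proof uses no linear functionals. If \<open>F\<close> is minimal usco and an open set \<open>W\<close> meets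
  \<open>F x\<close>, then every neighbourhood of \<open>x\<close> contains a point \<open>u\<close> with \<open>F u \<subseteq> W\<close>, for otherwise
  cutting \<open>W\<close> out of \<open>F\<close> near \<open>x\<close> would leave a smaller usco map. Taking \<open>W\<close> to be a small convex
  neighbourhood of a point \<open>y\<close> of \<open>F x\<close>, the whole closed convex hull of \<open>F u\<close> is close to \<open>y\<close>.
  Hence every usco map \<open>G\<close> contained in the hull map of \<open>F\<close> has \<open>y\<close> in \<open>G x\<close>, that is, \<open>G\<close>
  contains \<open>F\<close>. This one fact yields both the minimality of the hull map of \<open>F\<close> and injectivity;
  surjectivity follows by choosing, with Zorn's lemma, a minimal usco map inside a given minimal
  cusco map.
\<close>

section \<open>Convexity and neighbourhoods in locally convex spaces\<close>

text \<open>Subtraction is continuous at \<open>(0, 0)\<close>, so differences of small vectors stay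
  in \<open>U\<close>; local convexity then shrinks the neighbourhood to a convex one.\<close>

lemma convex_zero_neighbourhood_diff:
  fixes U :: "'b::locally_convex_space set"
  assumes "open U" "0 \<in> U"
  obtains V where "open V" "convex V" "0 \<in> V" "\<And>a b. a \<in> V \<Longrightarrow> b \<in> V \<Longrightarrow> a - b \<in> U"
proof -
  have "continuous_on UNIV (\<lambda>p::'b \<times> 'b. fst p - snd p)"
    by (intro continuous_intros)
  then have "open ((\<lambda>p::'b \<times> 'b. fst p - snd p) -` U)"
    using assms(1) by (rule open_vimage[rotated])
  moreover have "(0, 0) \<in> (\<lambda>p::'b \<times> 'b. fst p - snd p) -` U"
    using assms(2) by simp
  ultimately obtain A B where AB: "open A" "open B" "(0, 0) \<in> A \<times> B"
      "A \<times> B \<subseteq> (\<lambda>p::'b \<times> 'b. fst p - snd p) -` U"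
    by (rule open_prod_elim)
  then obtain V where V: "open V" "convex V" "0 \<in> V" "V \<subseteq> A \<inter> B"
    using locally_convex_0[of "A \<inter> B"] by auto
  have "a - b \<in> U" if "a \<in> V" "b \<in> V" for a b
  proof -
    have "(a, b) \<in> A \<times> B"
      using that V(4) by auto
    then show ?thesis
      using AB(4) by auto
  qed
  with V show ?thesis
    by (intro that[of V])
qed

lemma open_translation_preimage:
  fixes S :: "'b::topological_ab_group_add set"
  assumes "open S"
  shows "open {w. x + w \<in> S}" "open {w. w - x \<in> S}"
proof -
  have "continuous_on UNIV (\<lambda>w. x + w)" "continuous_on UNIV (\<lambda>w. w - x)"
    by (intro continuous_intros)+
  then show "open {w. x + w \<in> S}" "open {w. w - x \<in> S}"
    using open_vimage[OF assms] by (auto simp: vimage_def)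
qed

lemma closure_diff_neighbourhood:
  fixes A :: "'b::topological_ab_group_add set"
  assumes "z \<in> closure A" "open V" "0 \<in> V"
  obtains v where "v \<in> V" "z + v \<in> A"
proof -
  have "open {w. w - z \<in> V}"
    using assms(2) by (rule open_translation_preimage)
  moreover have "z \<in> {w. w - z \<in> V}"
    using assms(3) by simp
  ultimately obtain a where "a \<in> A" "a - z \<in> V"
    using assms(1) by (metis (no_types, lifting) closure_iff_nhds_not_empty disjoint_iff
      mem_Collect_eq order_refl)
  then show ?thesis
    by (intro that[of "a - z"]) auto
qed

text \<open>Points of \<open>A\<close> near \<open>x\<close> and \<open>y\<close> differ from them
  by \<open>a\<close> and \<open>b\<close> in one convex \<open>V\<close>. The same combination of
  the two errors is again in \<open>V\<close>, so it moves \<open>?z\<close> only within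
  \<open>S\<close>.\<close>

lemma convex_closure_locally_convex:
  fixes A :: "'b::locally_convex_space set"
  assumes "convex A"
  shows "convex (closure A)"
proof (rule convexI)
  fix x y :: 'b and u v :: real
  assume xy: "x \<in> closure A" "y \<in> closure A" and uv: "0 \<le> u" "0 \<le> v" "u + v = 1"
  let ?z = "u *\<^sub>R x + v *\<^sub>R y"
  have "A \<inter> S \<noteq> {}" if S: "open S" "?z \<in> S" for S
  proof -
    have "open {w. ?z + w \<in> S}" "0 \<in> {w. ?z + w \<in> S}"
      using open_translation_preimage[OF S(1)] S(2) by auto
    then obtain V where V: "open V" "convex V" "0 \<in> V" "V \<subseteq> {w. ?z + w \<in> S}"
      using locally_convex_0 by meson
    obtain a where a: "a \<in> V" "x + a \<in> A"
      using xy(1) V(1,3) by (rule closure_diff_neighbourhood) blast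
    obtain b where b: "b \<in> V" "y + b \<in> A"
      using xy(2) V(1,3) by (rule closure_diff_neighbourhood) blast
    have "u *\<^sub>R a + v *\<^sub>R b \<in> V"
      using V(2) a(1) b(1) uv by (rule convexD)
    then have "?z + (u *\<^sub>R a + v *\<^sub>R b) \<in> S"
      using V(4) by auto
    moreover have "u *\<^sub>R (x + a) + v *\<^sub>R (y + b) \<in> A"
      using assms a(2) b(2) uv by (rule convexD)
    moreover have "u *\<^sub>R (x + a) + v *\<^sub>R (y + b) = ?z + (u *\<^sub>R a + v *\<^sub>R b)"
      by (simp add: algebra_simps)
    ultimately show ?thesis
      by auto
  qed
  then show "?z \<in> closure A"
    unfolding closure_iff_nhds_not_empty by blast
qed

text \<open>A Lebesgue number argument: finitely many translated neighbourhoods cover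
  \<open>K\<close>, and intersecting the neighbourhoods of zero belonging to them gives one that
  serves all of \<open>K\<close>.\<close>

lemma compact_uniform_neighbourhood:
  fixes K :: "'b::locally_convex_space set"
  assumes "compact K" "open U" "K \<subseteq> U"
  obtains V where "open V" "0 \<in> V" "\<And>k v. k \<in> K \<Longrightarrow> v \<in> V \<Longrightarrow> k + v \<in> U"
proof -
  have "\<exists>V. open V \<and> 0 \<in> V \<and> (\<forall>a\<in>V. \<forall>b\<in>V. k + (a - b) \<in> U)" if "k \<in> K" for k
  proof -
    have "open {w. k + w \<in> U}" "0 \<in> {w. k + w \<in> U}"
      using open_translation_preimage[OF assms(2)] assms(3) that by auto
    then obtain V where "open V" "convex V" "0 \<in> V"
        "\<And>a b. a \<in> V \<Longrightarrow> b \<in> V \<Longrightarrow> a - b \<in> {w. k + w \<in> U}"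
      by (rule convex_zero_neighbourhood_diff) blast
    then show ?thesis
      by auto
  qed
  then obtain V where V: "\<And>k. k \<in> K \<Longrightarrow> open (V k)" "\<And>k. k \<in> K \<Longrightarrow> 0 \<in> V k"
      "\<And>k a b. k \<in> K \<Longrightarrow> a \<in> V k \<Longrightarrow> b \<in> V k \<Longrightarrow> k + (a - b) \<in> U"
    by metis
  let ?N = "\<lambda>k. {w. k - w \<in> V k}"
  have "open (?N k)" if "k \<in> K" for k
  proof -
    have "continuous_on UNIV (\<lambda>w. k - w)"
      by (intro continuous_intros)
    then show ?thesis
      using open_vimage[OF V(1)[OF that]] by (auto simp: vimage_def)
  qed
  moreover have "K \<subseteq> (\<Union>k\<in>K. ?N k)"
    using V(2) by auto
  ultimately obtain D where D: "D \<subseteq> K" "finite D" "K \<subseteq> (\<Union>k\<in>D. ?N k)"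
    using compactE_image[OF assms(1), of K ?N] by blast
  show ?thesis
  proof (rule that[of "\<Inter>k\<in>D. V k"])
    show "open (\<Inter>k\<in>D. V k)"
      using D V(1) by (intro open_INT) auto
    show "0 \<in> (\<Inter>k\<in>D. V k)"
      using D V(2) by auto
    fix k v assume "k \<in> K" "v \<in> (\<Inter>k\<in>D. V k)"
    with D obtain d where d: "d \<in> D" "d - k \<in> V d" "v \<in> V d"
      by blast
    \<comment> \<open>Rewriting \<open>k + v\<close> around the centre \<open>d\<close> leaves a
      difference of two elements of \<open>V d\<close>.\<close>
    then have "d + (v - (d - k)) \<in> U"
      using D(1) V(3) by blast
    then show "k + v \<in> U"
      by (simp add: algebra_simps)
  qed
qed

text \<open>The set \<open>C\<close> is the sum of \<open>K\<close> and a small convex neighbourhood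
  \<open>W\<close> of zero. Passing to the closure costs one more error from \<open>W\<close>, which
  is why differences from \<open>W\<close> must lie in the uniform neighbourhood
  \<open>V\<close>.\<close>

lemma compact_convex_neighbourhood_closure:
  fixes K :: "'b::locally_convex_space set"
  assumes "compact K" "convex K" "open U" "K \<subseteq> U"
  obtains C where "open C" "convex C" "K \<subseteq> C" "closure C \<subseteq> U"
proof -
  obtain V where V: "open V" "0 \<in> V" "\<And>k v. k \<in> K \<Longrightarrow> v \<in> V \<Longrightarrow> k + v \<in> U"
    using assms(1,3,4) by (rule compact_uniform_neighbourhood) blast
  obtain W where W: "open W" "convex W" "0 \<in> W" "\<And>a b. a \<in> W \<Longrightarrow> b \<in> W \<Longrightarrow> a - b \<in> V"
    using V(1,2) by (rule convex_zero_neighbourhood_diff) blast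
  let ?C = "\<Union>k\<in>K. \<Union>w\<in>W. {k + w}"
  show ?thesis
  proof (rule that[of ?C])
    have "?C = (\<Union>k\<in>K. {w. w - k \<in> W})"
      by (auto simp: algebra_simps) (metis add.commute diff_add_cancel)
    then show "open ?C"
      using open_translation_preimage(2)[OF W(1)] by auto
    show "convex ?C"
      using assms(2) W(2) by (rule convex_sums)
    show "K \<subseteq> ?C"
      using W(3) by force
    show "closure ?C \<subseteq> U"
    proof
      fix z assume "z \<in> closure ?C"
      then obtain v where "v \<in> W" "z + v \<in> ?C"
        using W(1,3) by (rule closure_diff_neighbourhood) blast
      then obtain k w where kw: "k \<in> K" "w \<in> W" "z + v = k + w"
        by auto
      then have "k + (w - v) \<in> U"
        using V(3) W(4) \<open>v \<in> W\<close> by blast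
      moreover have "k + (w - v) = z"
        using kw(3) by (simp add: algebra_simps)
      ultimately show "z \<in> U"
        by simp
    qed
  qed
qed

section \<open>Closed convex hulls and the hull map\<close>

lemma subset_closed_convex_hull: "B \<subseteq> closed_convex_hull B"
  unfolding closed_convex_hull_def using hull_subset closure_subset by (rule order_trans)

lemma closed_convex_hull_subset_closure:
  "B \<subseteq> C \<Longrightarrow> convex C \<Longrightarrow> closed_convex_hull B \<subseteq> closure C"
  unfolding closed_convex_hull_def by (intro closure_mono hull_minimal)

lemma closed_convex_hull_minimal:
  "B \<subseteq> C \<Longrightarrow> convex C \<Longrightarrow> closed C \<Longrightarrow> closed_convex_hull B \<subseteq> C"
  using closed_convex_hull_subset_closure by (metis closure_closed)

lemma convex_closed_convex_hull:
  fixes B :: "'b::locally_convex_space set"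
  shows "convex (closed_convex_hull B)"
  unfolding closed_convex_hull_def by (intro convex_closure_locally_convex convex_convex_hull)

lemma upper_semicontinuousI:
  assumes "\<And>x V. open V \<Longrightarrow> F x \<subseteq> V \<Longrightarrow> \<exists>U. open U \<and> x \<in> U \<and> (\<forall>u\<in>U. F u \<subseteq> V)"
  shows "upper_semicontinuous F"
  using assms unfolding upper_semicontinuous_def by simp

lemma usco_neighbourhood:
  assumes "usco F" "open V" "F x \<subseteq> V"
  obtains U where "open U" "x \<in> U" "\<And>u. u \<in> U \<Longrightarrow> F u \<subseteq> V"
proof -
  have "\<exists>U. open U \<and> x \<in> U \<and> (\<forall>u\<in>U. F u \<subseteq> V)"
    using assms unfolding usco_def upper_semicontinuous_def by simp
  then show ?thesis
    using that by auto
qed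

text \<open>For upper semicontinuity, a convex open \<open>C\<close> with closure inside
  \<open>V\<close> is put around the hull at \<open>x\<close>. Wherever \<open>F u\<close> lies in
  \<open>C\<close>, its closed hull lies in \<open>closure C\<close>, hence in
  \<open>V\<close>.\<close>

lemma cusco_hull_map:
  fixes F :: "'a::topological_space \<Rightarrow> 'b::locally_convex_space set"
  assumes F: "usco F" and compact_hull: "\<And>x. compact (closed_convex_hull (F x))"
  shows "cusco (hull_map F)"
proof -
  have "\<exists>U. open U \<and> x \<in> U \<and> (\<forall>u\<in>U. hull_map F u \<subseteq> V)"
    if V: "open V" "hull_map F x \<subseteq> V" for x V
  proof -
    obtain C where C: "open C" "convex C" "hull_map F x \<subseteq> C" "closure C \<subseteq> V"
      using compact_convex_neighbourhood_closure[of "hull_map F x" V]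
        compact_hull convex_closed_convex_hull V unfolding hull_map_def by metis
    have "F x \<subseteq> C"
      using C(3) subset_closed_convex_hull unfolding hull_map_def by blast
    with F C(1) obtain U where "open U" "x \<in> U" "\<And>u. u \<in> U \<Longrightarrow> F u \<subseteq> C"
      by (rule usco_neighbourhood) blast
    then show ?thesis
      using closed_convex_hull_subset_closure[OF _ C(2)] C(4) unfolding hull_map_def
      by (meson order_trans)
  qed
  then have "upper_semicontinuous (hull_map F)"
    by (rule upper_semicontinuousI)
  moreover have "hull_map F x \<noteq> {}" for x
    using F subset_closed_convex_hull[of "F x"] unfolding usco_def hull_map_def by auto
  moreover have "compact (hull_map F x)" "convex (hull_map F x)" for x
    unfolding hull_map_def by (rule compact_hull convex_closed_convex_hull)+
  ultimately show ?thesis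
    unfolding cusco_def usco_def by blast
qed

section \<open>Values of minimal usco maps\<close>

lemma minimal_usco_value_subset:
  fixes F :: "'a::topological_space \<Rightarrow> 'b::t2_space set"
  assumes F: "minimal_usco F" and U: "open U" "x \<in> U" and W: "open W" "F x \<inter> W \<noteq> {}"
  shows "\<exists>u\<in>U. F u \<subseteq> W"
proof (rule ccontr)
  assume "\<not> (\<exists>u\<in>U. F u \<subseteq> W)"
  then have ne: "F u - W \<noteq> {}" if "u \<in> U" for u
    using that by blast
  define G where "G u = (if u \<in> U then F u - W else F u)" for u
  have usco: "usco F"
    using F unfolding minimal_usco_def by blast
  have "\<exists>T. open T \<and> z \<in> T \<and> (\<forall>u\<in>T. G u \<subseteq> V)" if V: "open V" "G z \<subseteq> V" for z V
  proof (cases "z \<in> U")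
    case True
    \<comment> \<open>Adding \<open>W\<close> back turns a neighbourhood of \<open>G z\<close> into
      one of \<open>F z\<close>; over \<open>U\<close> the part in \<open>W\<close> is removed
      again.\<close>
    then have "F z \<subseteq> V \<union> W"
      using V(2) unfolding G_def by auto
    with usco open_Un[OF V(1) W(1)] obtain T
      where T: "open T" "z \<in> T" "\<And>u. u \<in> T \<Longrightarrow> F u \<subseteq> V \<union> W"
      by (rule usco_neighbourhood) blast
    then show ?thesis
      using U(1) True by (intro exI[of _ "T \<inter> U"]) (auto simp: G_def)
  next
    case False
    \<comment> \<open>The neighbourhood \<open>T\<close> may meet \<open>U\<close>, which is
      harmless because \<open>G\<close> is contained in \<open>F\<close> everywhere.\<close>
    then have "F z \<subseteq> V"
      using V(2) unfolding G_def by auto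
    with usco V(1) obtain T where T: "open T" "z \<in> T" "\<And>u. u \<in> T \<Longrightarrow> F u \<subseteq> V"
      by (rule usco_neighbourhood) blast
    then show ?thesis
      by (intro exI[of _ T]) (auto simp: G_def)
  qed
  then have "upper_semicontinuous G"
    by (rule upper_semicontinuousI)
  moreover have "G z \<noteq> {} \<and> compact (G z)" for z
    using usco ne[of z] compact_diff[OF _ W(1)] unfolding usco_def G_def by simp
  ultimately have "usco G"
    unfolding usco_def by blast
  moreover have "submap G F"
    unfolding submap_def G_def by auto
  ultimately have "G = F"
    using F unfolding minimal_usco_def by blast
  moreover have "G x = F x - W"
    using U(2) by (simp add: G_def)
  ultimately show False
    using W(2) by auto
qed

lemma minimal_usco_submap_if_submap_hull_map:
  fixes F :: "'a::topological_space \<Rightarrow> 'b::{locally_convex_space, t2_space} set"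
  assumes F: "minimal_usco F" and G: "usco G" "submap G (hull_map F)"
  shows "submap F G"
  unfolding submap_def
proof (intro allI subsetI, rule ccontr)
  fix x y assume y: "y \<in> F x" "y \<notin> G x"
  have "open (- G x)"
    using G(1) unfolding usco_def by (simp add: compact_imp_closed open_Compl)
  \<comment> \<open>The compact convex set enlarged here is a single point; \<open>C\<close>
    separates \<open>y\<close> from \<open>G x\<close> even after taking closures.\<close>
  then obtain C where C: "open C" "convex C" "{y} \<subseteq> C" "closure C \<subseteq> - G x"
    using compact_convex_neighbourhood_closure[of "{y}" "- G x"] y(2) by auto
  have "open (- closure C)" "G x \<subseteq> - closure C"
    using C(4) by auto
  with G(1) obtain U where U: "open U" "x \<in> U" "\<And>u. u \<in> U \<Longrightarrow> G u \<subseteq> - closure C"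
    by (rule usco_neighbourhood) blast
  have "F x \<inter> C \<noteq> {}"
    using y(1) C(3) by auto
  with F U(1,2) C(1) obtain u where u: "u \<in> U" "F u \<subseteq> C"
    using minimal_usco_value_subset by blast
  have "G u \<subseteq> closure C"
    using G(2) closed_convex_hull_subset_closure[OF u(2) C(2)]
    unfolding submap_def hull_map_def by blast
  \<comment> \<open>The value \<open>G u\<close> lies both in \<open>closure C\<close> and in its
    complement, yet it is nonempty.\<close>
  then show False
    using U(3)[OF u(1)] G(1) unfolding usco_def by blast
qed

section \<open>Existence of minimal usco maps inside usco maps\<close>

text \<open>By compactness, finitely many complements of members already cover
  \<open>K i0 - V\<close>. A member below \<open>K i0\<close> and below those finitely many has no
  point outside \<open>V\<close>.\<close>

lemma compact_chain_Inter_subset_open: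
  fixes K :: "'i \<Rightarrow> 'b::t2_space set"
  assumes "I \<noteq> {}" and compact: "\<And>i. i \<in> I \<Longrightarrow> compact (K i)"
    and chain: "\<And>i j. i \<in> I \<Longrightarrow> j \<in> I \<Longrightarrow> K i \<subseteq> K j \<or> K j \<subseteq> K i"
    and "open V" "(\<Inter>i\<in>I. K i) \<subseteq> V"
  shows "\<exists>i\<in>I. K i \<subseteq> V"
proof -
  obtain i0 where i0: "i0 \<in> I"
    using assms(1) by blast
  have "K i0 - V \<subseteq> (\<Union>i\<in>I. - K i)"
    using assms(5) by auto
  moreover have "compact (K i0 - V)"
    using compact[OF i0] assms(4) by (rule compact_diff)
  moreover have "open (- K i)" if "i \<in> I" for i
    using compact[OF that] by (intro open_Compl compact_imp_closed)
  ultimately obtain D where D: "D \<subseteq> I" "finite D" "K i0 - V \<subseteq> (\<Union>i\<in>D. - K i)"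
    using compactE_image[of "K i0 - V" I "\<lambda>i. - K i"] by blast
  \<comment> \<open>Inclusion in \<open>K i0\<close> is carried through the induction, so an empty
    \<open>D\<close> causes no trouble.\<close>
  have "\<exists>i\<in>I. K i \<subseteq> K i0 \<and> (\<forall>j\<in>D. K i \<subseteq> K j)"
    using D(2,1)
  proof (induction D rule: finite_induct)
    case empty
    then show ?case
      using i0 by auto
  next
    case (insert j D)
    then obtain i where i: "i \<in> I" "K i \<subseteq> K i0" "\<forall>j\<in>D. K i \<subseteq> K j"
      by auto
    with insert.prems have "K i \<subseteq> K j \<or> K j \<subseteq> K i"
      by (intro chain) auto
    then show ?case
    proof
      assume "K i \<subseteq> K j"
      with i show ?thesis
        by (intro bexI[of _ i]) auto
    next
      assume "K j \<subseteq> K i"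
      with i insert.prems show ?thesis
        by (intro bexI[of _ j]) auto
    qed
  qed
  then show ?thesis
    using D(3) by blast
qed

text \<open>Fact \<open>ex\<close> reduces everything to one member of the chain: an open set around
  the intersection at \<open>x\<close> already contains some \<open>G x\<close>. Taking the empty
  open set shows that the intersection is nonempty.\<close>

lemma usco_chain_Inter:
  fixes C :: "('a::topological_space \<Rightarrow> 'b::t2_space set) set"
  assumes "C \<noteq> {}" and usco: "\<And>G. G \<in> C \<Longrightarrow> usco G"
    and chain: "\<And>G H. G \<in> C \<Longrightarrow> H \<in> C \<Longrightarrow> submap G H \<or> submap H G"
  shows "usco (\<lambda>x. \<Inter>G\<in>C. G x)"
proof -
  have cmp: "compact (G x)" if "G \<in> C" for G x
    using usco[OF that] unfolding usco_def by blast
  have ex: "\<exists>G\<in>C. G x \<subseteq> V" if "open V" "(\<Inter>G\<in>C. G x) \<subseteq> V" for x V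
  proof (rule compact_chain_Inter_subset_open[OF assms(1)])
    show "compact (G x)" if "G \<in> C" for G
      using that by (rule cmp)
    show "G x \<subseteq> H x \<or> H x \<subseteq> G x" if "G \<in> C" "H \<in> C" for G H
      using chain[OF that] unfolding submap_def by blast
  qed (use that in auto)
  have "(\<Inter>G\<in>C. G x) \<noteq> {}" for x
  proof
    assume "(\<Inter>G\<in>C. G x) = {}"
    then obtain G where "G \<in> C" "G x \<subseteq> {}"
      using ex[of "{}" x] by auto
    then show False
      using usco unfolding usco_def by blast
  qed
  moreover have "compact (\<Inter>G\<in>C. G x)" for x
  proof -
    obtain G where "G \<in> C"
      using assms(1) by blast
    moreover have "closed (\<Inter>G\<in>C. G x)"
      using cmp compact_imp_closed by blast
    ultimately have "compact (G x \<inter> (\<Inter>G\<in>C. G x))"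
      using cmp by blast
    moreover have "G x \<inter> (\<Inter>G\<in>C. G x) = (\<Inter>G\<in>C. G x)"
      using \<open>G \<in> C\<close> by auto
    ultimately show ?thesis
      by simp
  qed
  moreover have "upper_semicontinuous (\<lambda>x. \<Inter>G\<in>C. G x)"
  proof (rule upper_semicontinuousI)
    fix x V assume V: "open V" "(\<Inter>G\<in>C. G x) \<subseteq> V"
    then obtain G where G: "G \<in> C" "G x \<subseteq> V"
      using ex by blast
    obtain U where "open U" "x \<in> U" "\<And>u. u \<in> U \<Longrightarrow> G u \<subseteq> V"
      using usco[OF G(1)] V(1) G(2) by (rule usco_neighbourhood) blast
    then show "\<exists>U. open U \<and> x \<in> U \<and> (\<forall>u\<in>U. (\<Inter>G\<in>C. G u) \<subseteq> V)"
      using G(1) by blast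
  qed
  ultimately show ?thesis
    unfolding usco_def by blast
qed

lemma usco_contains_minimal_usco:
  fixes H :: "'a::topological_space \<Rightarrow> 'b::t2_space set"
  assumes "usco H"
  obtains F where "minimal_usco F" "submap F H"
proof -
  define A where "A = {G. usco G \<and> submap G H}"
  \<comment> \<open>The inclusion order is reversed, so that the maximal element from Zorn's lemma
    is a minimal map.\<close>
  define P where "P = (\<lambda>G F :: 'a \<Rightarrow> 'b set. submap F G)"
  have "partial_order_on A (relation_of P A)"
    by (rule partial_order_on_relation_ofI) (auto simp: P_def submap_def fun_eq_iff)
  moreover have "\<exists>u\<in>A. \<forall>G\<in>C. P G u" if C: "C \<in> Chains (relation_of P A)" for C
  proof (cases "C = {}")
    case True
    with assms show ?thesis
      by (auto simp: A_def submap_def)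
  next
    case False
    have sub: "C \<subseteq> A"
      using C by (auto simp: Chains_def relation_of_def)
    have ch: "submap G K \<or> submap K G" if "G \<in> C" "K \<in> C" for G K
      using C that by (auto simp: Chains_def relation_of_def P_def)
    have "usco (\<lambda>x. \<Inter>G\<in>C. G x)"
      using False ch sub by (intro usco_chain_Inter) (auto simp: A_def)
    moreover have "submap (\<lambda>x. \<Inter>G\<in>C. G x) H"
      using False sub unfolding submap_def A_def by blast
    ultimately show ?thesis
      by (intro bexI[of _ "\<lambda>x. \<Inter>G\<in>C. G x"]) (auto simp: A_def P_def submap_def)
  qed
  ultimately obtain F where F: "F \<in> A" "\<And>G. G \<in> A \<Longrightarrow> P F G \<Longrightarrow> G = F"
    using predicate_Zorn[of A P] by blast
  have "submap G H" if "submap G F" for G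
    using that F(1) unfolding A_def submap_def by blast
  then have "minimal_usco F"
    using F unfolding minimal_usco_def A_def P_def by blast
  with F(1) show ?thesis
    by (intro that) (auto simp: A_def)
qed

section \<open>The bijection between minimal usco and minimal cusco maps\<close>

lemma hull_map_submap_cusco:
  fixes G :: "'a::topological_space \<Rightarrow> 'b::{real_vector, t2_space} set"
  assumes "submap F G" "cusco G"
  shows "submap (hull_map F) G"
  using assms unfolding submap_def hull_map_def cusco_def usco_def
  by (simp add: closed_convex_hull_minimal compact_imp_closed)

theorem theorem2p6:
  assumes compact_hull:
    "\<And>K :: 'b::{locally_convex_space, t2_space} set. compact K \<Longrightarrow> compact (closed_convex_hull K)"
  shows "bij_betw hull_map (MU :: ('a::t2_space \<Rightarrow> 'b set) set) MC"
proof -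
  have cusco_hull: "cusco (hull_map F)" if "usco F" for F :: "'a \<Rightarrow> 'b set"
    using that compact_hull unfolding usco_def by (intro cusco_hull_map) (auto simp: usco_def)
  have antisym: "F = G" if "submap F G" "submap G F" for F G :: "'a \<Rightarrow> 'b set"
    using that unfolding submap_def by blast
  have "inj_on hull_map (MU :: ('a \<Rightarrow> 'b set) set)"
  proof (rule inj_onI)
    fix F G :: "'a \<Rightarrow> 'b set"
    assume "F \<in> MU" "G \<in> MU" and eq: "hull_map F = hull_map G"
    then have F: "minimal_usco F" "usco F" and G: "minimal_usco G"
      unfolding MU_def minimal_usco_def by auto
    \<comment> \<open>With equal hulls, \<open>G\<close> lies in the hull map of \<open>F\<close>,
      so \<open>G\<close> contains \<open>F\<close>; minimality of \<open>G\<close> then gives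
      equality.\<close>
    have "submap G (hull_map F)"
      unfolding eq by (simp add: submap_def hull_map_def subset_closed_convex_hull)
    with F(1) G have "submap F G"
      unfolding minimal_usco_def[of G] by (blast intro: minimal_usco_submap_if_submap_hull_map)
    with F(2) G show "F = G"
      unfolding minimal_usco_def by blast
  qed
  moreover have "hull_map F \<in> MC" if "F \<in> MU" for F :: "'a \<Rightarrow> 'b set"
  proof -
    have F: "minimal_usco F" "usco F"
      using that unfolding MU_def minimal_usco_def by auto
    have "G = hull_map F" if G: "cusco G" "submap G (hull_map F)" for G
    proof -
      \<comment> \<open>Once \<open>G\<close> contains \<open>F\<close>, its closed convex values
        contain the hulls as well, which is the reverse inclusion.\<close>
      have "submap F G"
        using F(1) G unfolding cusco_def by (blast intro: minimal_usco_submap_if_submap_hull_map)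
      then show ?thesis
        using G antisym hull_map_submap_cusco by blast
    qed
    then show ?thesis
      using cusco_hull[OF F(2)] unfolding MC_def minimal_cusco_def by blast
  qed
  moreover have "H \<in> hull_map ` MU" if "H \<in> MC" for H :: "'a \<Rightarrow> 'b set"
  proof -
    have H: "cusco H" "\<And>G. cusco G \<Longrightarrow> submap G H \<Longrightarrow> G = H"
      using that unfolding MC_def minimal_cusco_def by auto
    then obtain F where F: "minimal_usco F" "submap F H"
      unfolding cusco_def by (blast intro: usco_contains_minimal_usco)
    \<comment> \<open>The hull map of \<open>F\<close> is a cusco map inside \<open>H\<close>, so
      minimality of \<open>H\<close> forces equality.\<close>
    then have "hull_map F = H"
      using H cusco_hull hull_map_submap_cusco unfolding minimal_usco_def by blast
    with F(1) show ?thesis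
      unfolding MU_def by blast
  qed
  ultimately show ?thesis
    unfolding bij_betw_def by blast
qed

end
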